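(* Let $M$ be a compact complex manifold of complex dimension $m \geq 1$, and let $n$ be an integer with $n > m$. Then there is no holomorphic embedding of $M \times \mathbb{C}\mathrm{P}^n$ into $\mathbb{C}\mathrm{P}^{m+n+1}$.
   Context: $\mathbb{C}\mathrm{P}^k$ denotes the complex projective space of complex dimension $k$, and $M \times \mathbb{C}\mathrm{P}^n$ carries the product complex structure. Manifolds are understood to be nonempty and without boundary. A holomorphic embedding is an injective holomorphic immersion that is a homeomorphism onto its image. *)

theory Defs
  imports "HOL-Analysis.Analysis"
begin

text \<open>Complex differentiability in several variables: the real Frechet derivative exists at
  every point and is complex linear. Since \<open>at x\<close> looks at a full neighbourhood, \<open>S\<close> is meant to
  be open, as it is in all uses below.\<close>

definition holomorphic_vec_on :: "(complex^'m \<Rightarrow> complex^'n) \<Rightarrow> (complex^'m) set \<Rightarrow> bool" where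
  "holomorphic_vec_on f S \<longleftrightarrow>
     (\<forall>x\<in>S. \<exists>D. (f has_derivative D) (at x) \<and> Vector_Spaces.linear (*s) (*s) D)"

type_synonym ('a, 'm) chart = "'a set \<times> ('a \<Rightarrow> complex^'m)"

record ('a, 'm::finite) complex_space =
  points :: "'a topology"
  atlas :: "('a, 'm) chart set"

definition is_chart :: "'a topology \<Rightarrow> ('a, 'm::finite) chart \<Rightarrow> bool" where
  "is_chart X = (\<lambda>(U, \<phi>). openin X U \<and> open (\<phi> ` U) \<and>
     homeomorphic_map (subtopology X U) (top_of_set (\<phi> ` U)) \<phi>)"

definition holomorphic_atlas :: "'a topology \<Rightarrow> ('a, 'm::finite) chart set \<Rightarrow> bool" where
  "holomorphic_atlas X A \<longleftrightarrow>
     (\<forall>c\<in>A. is_chart X c) \<and> (\<Union>(U, \<phi>)\<in>A. U) = topspace X \<and>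
     (\<forall>(U, \<phi>)\<in>A. \<forall>(V, \<psi>)\<in>A. holomorphic_vec_on (\<psi> \<circ> inv_into U \<phi>) (\<phi> ` (U \<inter> V)))"

text \<open>The dimension is \<open>CARD('m)\<close>. The atlas need not be maximal, and connectedness is not
  required.\<close>

definition complex_manifold :: "('a, 'm::finite) complex_space \<Rightarrow> bool" where
  "complex_manifold M \<longleftrightarrow>
     topspace (points M) \<noteq> {} \<and> Hausdorff_space (points M) \<and> second_countable (points M) \<and>
     holomorphic_atlas (points M) (atlas M)"

definition vec_pair :: "complex^'m \<Rightarrow> complex^'n \<Rightarrow> complex^('m + 'n)" where
  "vec_pair x y = (\<chi> i. case i of Inl j \<Rightarrow> x $ j | Inr j \<Rightarrow> y $ j)"

definition prod_chart :: "('a, 'm) chart \<Rightarrow> ('b, 'n) chart \<Rightarrow> ('a \<times> 'b, 'm::finite + 'n::finite) chart" where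
  "prod_chart = (\<lambda>(U, \<phi>) (V, \<psi>). (U \<times> V, \<lambda>(p, q). vec_pair (\<phi> p) (\<psi> q)))"

definition prod_manifold ::
  "('a, 'm::finite) complex_space \<Rightarrow> ('b, 'n::finite) complex_space \<Rightarrow> ('a \<times> 'b, 'm + 'n) complex_space"
  where
  "prod_manifold M N =
     \<lparr>points = prod_topology (points M) (points N),
      atlas = {prod_chart c d |c d. c \<in> atlas M \<and> d \<in> atlas N}\<rparr>"

text \<open>The coordinate expression of a map in two charts, and the subset of coordinate space where
  it is meaningful, which is open if the map is continuous.\<close>

definition in_charts ::
  "('a, 'm) chart \<Rightarrow> ('b, 'n) chart \<Rightarrow> ('a \<Rightarrow> 'b) \<Rightarrow> complex^'m::finite \<Rightarrow> complex^'n::finite" where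
  "in_charts = (\<lambda>(U, \<phi>) (V, \<psi>) f. \<psi> \<circ> f \<circ> inv_into U \<phi>)"

definition in_charts_dom ::
  "('a, 'm::finite) chart \<Rightarrow> ('b, 'n::finite) chart \<Rightarrow> ('a \<Rightarrow> 'b) \<Rightarrow> (complex^'m) set" where
  "in_charts_dom = (\<lambda>(U, \<phi>) (V, \<psi>) f. \<phi> ` (U \<inter> f -` V))"

definition holomorphic_map ::
  "('a, 'm::finite) complex_space \<Rightarrow> ('b, 'n::finite) complex_space \<Rightarrow> ('a \<Rightarrow> 'b) \<Rightarrow> bool" where
  "holomorphic_map M N f \<longleftrightarrow>
     continuous_map (points M) (points N) f \<and>
     (\<forall>c\<in>atlas M. \<forall>d\<in>atlas N. holomorphic_vec_on (in_charts c d f) (in_charts_dom c d f))"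

definition holomorphic_immersion ::
  "('a, 'm::finite) complex_space \<Rightarrow> ('b, 'n::finite) complex_space \<Rightarrow> ('a \<Rightarrow> 'b) \<Rightarrow> bool" where
  "holomorphic_immersion M N f \<longleftrightarrow>
     holomorphic_map M N f \<and>
     (\<forall>c\<in>atlas M. \<forall>d\<in>atlas N. \<forall>x\<in>in_charts_dom c d f.
        \<exists>D. (in_charts c d f has_derivative D) (at x) \<and> inj D)"

definition holomorphic_embedding ::
  "('a, 'm::finite) complex_space \<Rightarrow> ('b, 'n::finite) complex_space \<Rightarrow> ('a \<Rightarrow> 'b) \<Rightarrow> bool" where
  "holomorphic_embedding M N f \<longleftrightarrow>
     holomorphic_immersion M N f \<and> inj_on f (topspace (points M)) \<and>
     embedding_map (points M) (points N) f"

text \<open>The points of the projective space of dimension \<open>CARD('k)\<close> are the complex lines through the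
  origin of \<open>complex^'k option\<close>, a space of dimension \<open>CARD('k) + 1\<close>; the topology is the quotient
  topology along \<open>v \<mapsto> vec.span {v}\<close> for \<open>v \<noteq> 0\<close>.\<close>

definition proj_lines :: "(complex^'k::finite option) set set" where
  "proj_lines = {vec.span {v} |v. v \<noteq> 0}"

definition proj_topology :: "(complex^'k::finite option) set topology" where
  "proj_topology = topology (\<lambda>U. U \<subseteq> proj_lines \<and> open {v. v \<noteq> 0 \<and> vec.span {v} \<in> U})"

text \<open>On the lines where the homogeneous coordinate \<open>i\<close> does not vanish, rescale the
  coordinate \<open>i\<close> to 1 and read off the other coordinates. They are indexed by \<open>'k\<close>, the index \<open>j\<close>
  standing for \<open>Some j\<close>, except that \<open>None\<close> takes the place of \<open>i\<close> if \<open>i = Some j\<close>.\<close>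

definition affine_coords :: "'k option \<Rightarrow> (complex^'k::finite option) set \<Rightarrow> complex^'k" where
  "affine_coords i L =
     (let v = (THE v. v \<in> L \<and> v $ i = 1) in \<chi> j. v $ (if i = Some j then None else Some j))"

definition affine_chart :: "'k::finite option \<Rightarrow> ((complex^'k option) set, 'k) chart" where
  "affine_chart i = ({L \<in> proj_lines. \<exists>v\<in>L. v $ i \<noteq> 0}, affine_coords i)"

definition CP :: "'k::finite itself \<Rightarrow> ((complex^'k option) set, 'k) complex_space" where
  "CP _ = \<lparr>points = proj_topology, atlas = range affine_chart\<rparr>"

end

theory Submission
  imports Defs "HOL-Complex_Analysis.Conformal_Mappings"
begin

text \<open>Frankel's argument. If \<open>p \<noteq> q\<close> are points of \<open>M\<close>, the embedding maps the fibres over \<open>p\<close>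
  and \<open>q\<close> to disjoint immersed copies of the projective space of dimension \<open>n\<close> in a projective space
  of dimension \<open>m + n + 1 \<le> 2 n\<close>. Let \<open>A\<close> and \<open>B\<close> be their cones and let unit vectors
  \<open>a \<in> A\<close>, \<open>b \<in> B\<close> maximise \<open>\<bar>\<langle>a, b\<rangle>\<bar>\<close>, with maximum \<open>c < 1\<close>. To first order, maximality makes the
  tangent directions of both images orthogonal to \<open>a\<close> and \<open>b\<close>, so by a dimension count
  they have a common tangent direction \<open>u \<noteq> 0\<close>. Moving both points in this direction changes
  \<open>Re \<langle>a, b\<rangle> - c \<parallel>a\<parallel> \<parallel>b\<parallel>\<close> to second order by \<open>(1 - c) \<bar>t\<bar>\<^sup>2 \<parallel>u\<parallel>\<^sup>2\<close> plus the real part of a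
  holomorphic function of \<open>t\<close> vanishing at 0, and this contradicts maximality.\<close>

subsection \<open>The second order argument for cones\<close>

definition cinner :: "complex^'k \<Rightarrow> complex^'k \<Rightarrow> complex" where
  "cinner x y = (\<Sum>i\<in>UNIV. x $ i * cnj (y $ i))"

lemma cinner_add_left: "cinner (x + y) z = cinner x z + cinner y z"
  by (simp add: cinner_def algebra_simps sum.distrib)

lemma cinner_diff_left: "cinner (x - y) z = cinner x z - cinner y z"
  by (simp add: cinner_def algebra_simps sum_subtractf)

lemma cinner_diff_right: "cinner x (y - z) = cinner x y - cinner x z"
  by (simp add: cinner_def algebra_simps sum_subtractf)

lemma cinner_scale_left: "cinner (c *s x) y = c * cinner x y"
  by (simp add: cinner_def algebra_simps sum_distrib_left)

lemma cinner_scale_right: "cinner x (c *s y) = cnj c * cinner x y"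
  by (simp add: cinner_def algebra_simps sum_distrib_left)

lemma cnj_cinner: "cnj (cinner x y) = cinner y x"
  by (simp add: cinner_def mult.commute)

lemma Re_cinner: "Re (cinner x y) = x \<bullet> y"
  by (simp add: cinner_def inner_vec_def inner_complex_def)

lemma cinner_self: "cinner x x = of_real ((norm x)\<^sup>2)"
proof (rule complex_eqI)
  show "Im (cinner x x) = Im (of_real ((norm x)\<^sup>2))"
    by (simp add: cinner_def)
qed (simp add: Re_cinner power2_norm_eq_inner)

lemma norm_scale: "norm (c *s x) = cmod c * norm (x :: complex^'k)"
proof -
  have "(norm (c *s x))\<^sup>2 = (cmod c * norm x)\<^sup>2"
    using cinner_self[of "c *s x"] complex_norm_square[of c]
    by (metis cinner_scale_left cinner_scale_right cinner_self mult.assoc of_real_eq_iff of_real_mult power_mult_distrib)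
  then show ?thesis
    by (simp add: power2_eq_iff_nonneg)
qed

text \<open>Multiply \<open>x\<close> by the conjugate phase of the pairing. This reduces statements
  about the modulus to statements about the real inner product.\<close>

lemma phase_cinner:
  obtains \<omega> where "cmod \<omega> = 1" "cinner (\<omega> *s x) y = of_real (cmod (cinner x y))"
proof (cases "cinner x y = 0")
  case True
  then show thesis using that[of 1] by simp
next
  case False
  define \<omega> where "\<omega> = cnj (cinner x y) / of_real (cmod (cinner x y))"
  have "cmod \<omega> = 1" using False by (simp add: \<omega>_def norm_divide)
  moreover have "cinner (\<omega> *s x) y = of_real (cmod (cinner x y))"
    using False by (simp add: \<omega>_def cinner_scale_left complex_norm_square[symmetric] power2_eq_square mult.commute)
  ultimately show thesis by (rule that)
qed

lemma norm_cinner_le: "cmod (cinner x y) \<le> norm x * norm y"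
proof -
  obtain \<omega> where w: "cmod \<omega> = 1" "cinner (\<omega> *s x) y = of_real (cmod (cinner x y))"
    by (rule phase_cinner)
  have "cmod (cinner x y) = (\<omega> *s x) \<bullet> y"
    using w(2) Re_cinner[of "\<omega> *s x" y] by simp
  also have "\<dots> \<le> norm (\<omega> *s x) * norm y" by (rule norm_cauchy_schwarz)
  finally show ?thesis by (simp add: norm_scale w)
qed

text \<open>The equality case of Cauchy-Schwarz: the squared distance of two unit vectors is 2 minus
  twice the real part of their pairing. It excludes the maximum 1 for disjoint cones.\<close>

lemma norm_cinner_eq_1:
  assumes "norm x = 1" "norm y = 1" "cinner x y = 1"
  shows "x = y"
proof -
  have "x \<bullet> y = 1" using Re_cinner[of x y] assms(3) by simp
  then have "norm (x - y) ^ 2 = 0"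
    using assms by (simp add: power2_norm_eq_inner inner_diff_left inner_diff_right inner_commute norm_eq_1)
  then show ?thesis by simp
qed

lemma tendsto_cinner [tendsto_intros]:
  assumes "(f \<longlongrightarrow> x) F" "(g \<longlongrightarrow> y) F"
  shows "((\<lambda>t. cinner (f t) (g t)) \<longlongrightarrow> cinner x y) F"
  unfolding cinner_def by (intro tendsto_intros assms)

lemma continuous_on_cinner [continuous_intros]:
  assumes "continuous_on S f" "continuous_on S g"
  shows "continuous_on S (\<lambda>t. cinner (f t) (g t))"
  unfolding cinner_def by (intro continuous_intros assms)

lemma holomorphic_on_cinner:
  assumes "\<And>j. (\<lambda>t. f t $ j) holomorphic_on S"
  shows "(\<lambda>t. cinner (f t) y) holomorphic_on S"
  unfolding cinner_def by (intro holomorphic_intros assms)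

text \<open>A homogeneous lift of a holomorphic curve in projective space, scaled to have pairing 1 with
  its value at 0. Its derivative \<open>u\<close> is then orthogonal to \<open>a\<close>, and \<open>\<parallel>\<gamma> t\<parallel>\<^sup>2 = 1 + \<parallel>\<gamma> t - a\<parallel>\<^sup>2\<close>.\<close>

definition normalized_curve :: "real \<Rightarrow> (complex \<Rightarrow> complex^'k) \<Rightarrow> complex^'k \<Rightarrow> complex^'k \<Rightarrow> bool" where
  "normalized_curve r \<gamma> a u \<longleftrightarrow> r > 0 \<and> \<gamma> 0 = a \<and> (\<forall>t\<in>ball 0 r. cinner (\<gamma> t) a = 1) \<and>
     (\<forall>j. (\<lambda>t. \<gamma> t $ j) holomorphic_on ball 0 r) \<and>
     (\<forall>j. ((\<lambda>t. \<gamma> t $ j) has_field_derivative u $ j) (at 0))"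

section \<open>First and second variation along normalized curves\<close>

lemma normalized_curve_mono:
  assumes "normalized_curve r \<gamma> a u" "0 < s" "s \<le> r"
  shows "normalized_curve s \<gamma> a u"
  using assms holomorphic_on_subset[OF _ subset_ball[OF assms(3)]]
  unfolding normalized_curve_def by fastforce

lemma normalized_curve_tendsto:
  assumes "normalized_curve r \<gamma> a u" "t \<longlonglongrightarrow> 0" "\<And>n. t n \<noteq> 0"
  shows "(\<lambda>n. inverse (t n) *s (\<gamma> (t n) - a)) \<longlonglongrightarrow> u"
proof (rule vec_tendstoI)
  fix j
  have "((\<lambda>t. \<gamma> t $ j) has_field_derivative u $ j) (at 0)" and a: "\<gamma> 0 = a"
    using assms(1) by (auto simp: normalized_curve_def)
  then have "((\<lambda>t. (\<gamma> t $ j - \<gamma> 0 $ j) / t) \<longlongrightarrow> u $ j) (at 0)"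
    by (simp add: has_field_derivative_iff)
  moreover have "filterlim t (at 0) sequentially"
    using assms(2,3) by (simp add: filterlim_at)
  ultimately have "(\<lambda>n. (\<gamma> (t n) $ j - \<gamma> 0 $ j) / t n) \<longlonglongrightarrow> u $ j"
    by (rule filterlim_compose)
  then show "(\<lambda>n. (inverse (t n) *s (\<gamma> (t n) - a)) $ j) \<longlonglongrightarrow> u $ j"
    by (simp add: a divide_inverse mult.commute algebra_simps)
qed

text \<open>Pythagoras: pairing 1 with the unit vector \<open>a\<close> makes
  \<open>\<gamma> t - a\<close> orthogonal to \<open>a\<close>.\<close>

lemma normalized_curve_norm_square:
  assumes "normalized_curve r \<gamma> a u" "norm a = 1" "t \<in> ball 0 r"
  shows "(norm (\<gamma> t))\<^sup>2 = 1 + (norm (\<gamma> t - a))\<^sup>2"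
proof -
  have "\<gamma> t \<bullet> a = 1"
    using assms Re_cinner[of "\<gamma> t" a] by (auto simp: normalized_curve_def)
  then show ?thesis
    using assms(2) by (simp add: power2_norm_eq_inner inner_diff_left inner_diff_right inner_commute norm_eq_1)
qed

lemma normalized_curve_norm_le:
  assumes "normalized_curve r \<gamma> a u" "norm a = 1" "t \<in> ball 0 r"
  shows "norm (\<gamma> t) \<le> 1 + (norm (\<gamma> t - a))\<^sup>2 / 2"
proof (rule power2_le_imp_le)
  show "(norm (\<gamma> t))\<^sup>2 \<le> (1 + (norm (\<gamma> t - a))\<^sup>2 / 2)\<^sup>2"
    unfolding normalized_curve_norm_square[OF assms] by (simp add: power2_sum)
qed simp

text \<open>If the pairing \<open>\<kappa>\<close> of \<open>u\<close> and \<open>b\<close> were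
  nonzero, moving \<open>t\<close> in the direction of \<open>cnj \<kappa>\<close> would raise the
  real part of the pairing to first order, whereas the norm of \<open>\<gamma>\<close> grows only to
  second order. The case \<open>b = a\<close>, \<open>c = 1\<close> gives orthogonality to
  \<open>a\<close> itself.\<close>

lemma normalized_curve_critical:
  assumes \<gamma>: "normalized_curve r \<gamma> a u" and [simp]: "norm a = 1"
    and c: "0 \<le> c" "cinner a b = of_real c"
    and le: "\<And>t. t \<in> ball 0 r \<Longrightarrow> cmod (cinner (\<gamma> t) b) \<le> c * norm (\<gamma> t)"
  shows "cinner u b = 0"
proof (rule ccontr)
  define \<kappa> where "\<kappa> = cinner u b"
  assume "cinner u b \<noteq> 0"
  then have \<kappa>: "\<kappa> \<noteq> 0" by (simp add: \<kappa>_def)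
  have r: "r > 0" using \<gamma> by (simp add: normalized_curve_def)
  \<comment> \<open>This scaling gives \<open>cmod (t n) = r / (real n + 2)\<close>, which is below
    \<open>r\<close> already for \<open>n = 0\<close>.\<close>
  define s where "s n = r / cmod \<kappa> / (real n + 2)" for n
  define t where "t n = of_real (s n) * cnj \<kappa>" for n
  have s0: "s n > 0" for n using r \<kappa> by (simp add: s_def)
  have slim: "s \<longlonglongrightarrow> 0" unfolding s_def by real_asymp
  have t0: "t n \<noteq> 0" for n using s0[of n] \<kappa> by (simp add: t_def)
  have "t \<longlonglongrightarrow> of_real 0 * cnj \<kappa>" unfolding t_def by (intro tendsto_intros slim)
  then have tlim: "t \<longlonglongrightarrow> 0" by simp
  have tball: "t n \<in> ball 0 r" for n
  proof -
    have "cmod (t n) = r / (real n + 2)"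
      using s0[of n] \<kappa> by (simp add: t_def norm_mult) (simp add: s_def)
    then show ?thesis using r by (simp add: divide_less_eq)
  qed
  define Q where "Q n = inverse (t n) *s (\<gamma> (t n) - a)" for n
  have Qlim: "Q \<longlonglongrightarrow> u"
    unfolding Q_def by (rule normalized_curve_tendsto[OF \<gamma> tlim t0])
  have Q: "\<gamma> (t n) - a = t n *s Q n" for n
    by (simp add: Q_def t0)
  have ineq: "Re (cnj \<kappa> * cinner (Q n) b) \<le> c * s n * (cmod \<kappa>)\<^sup>2 * (norm (Q n))\<^sup>2 / 2" for n
  proof -
    have "Re (cinner (\<gamma> (t n)) b) \<le> c * (1 + (norm (\<gamma> (t n) - a))\<^sup>2 / 2)"
      using complex_Re_le_cmod[of "cinner (\<gamma> (t n)) b"] le[OF tball[of n]]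
        mult_left_mono[OF normalized_curve_norm_le[OF \<gamma> _ tball[of n]] c(1)] by simp
    moreover have "cinner (\<gamma> (t n)) b = c + t n * cinner (Q n) b"
      using cinner_diff_left[of "\<gamma> (t n)" a b] by (simp add: Q c cinner_scale_left algebra_simps)
    ultimately have "Re (t n * cinner (Q n) b) \<le> c * (cmod (t n) * norm (Q n))\<^sup>2 / 2"
      by (simp add: Q norm_scale algebra_simps)
    then have "s n * Re (cnj \<kappa> * cinner (Q n) b) \<le> s n * (c * s n * (cmod \<kappa>)\<^sup>2 * (norm (Q n))\<^sup>2 / 2)"
      using s0[of n] by (simp add: t_def norm_mult power2_eq_square algebra_simps)
    then show ?thesis using s0[of n] by simp
  qed
  \<comment> \<open>After the division by \<open>s n\<close> the right side still carries a factor
    \<open>s n\<close>, so it tends to 0.\<close>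
  have "Re (cnj \<kappa> * cinner u b) \<le> c * 0 * (cmod \<kappa>)\<^sup>2 * (norm u)\<^sup>2 / 2"
  proof (rule LIMSEQ_le)
    show "(\<lambda>n. Re (cnj \<kappa> * cinner (Q n) b)) \<longlonglongrightarrow> Re (cnj \<kappa> * cinner u b)"
      by (intro tendsto_intros Qlim)
    show "(\<lambda>n. c * s n * (cmod \<kappa>)\<^sup>2 * (norm (Q n))\<^sup>2 / 2) \<longlonglongrightarrow> c * 0 * (cmod \<kappa>)\<^sup>2 * (norm u)\<^sup>2 / 2"
      by (intro tendsto_intros Qlim slim) auto
  qed (use ineq in auto)
  then have "(cmod \<kappa>)\<^sup>2 \<le> 0"
    using complex_norm_square[of \<kappa>] by (simp add: \<kappa>_def[symmetric] cmod_power2) (simp add: power2_eq_square)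
  with \<kappa> show False by simp
qed

text \<open>By the maximum modulus principle for \<open>exp \<circ> H\<close>.\<close>

lemma holomorphic_Re_ge_on_circle:
  assumes "H holomorphic_on ball 0 r" "H 0 = 0" "0 < s" "s < r"
  obtains t where "cmod t = s" "Re (H t) \<ge> 0"
proof (rule ccontr)
  assume "\<not> thesis"
  then have neg: "Re (H t) < 0" if "cmod t = s" for t
    using that \<open>\<And>t. \<lbrakk>cmod t = s; 0 \<le> Re (H t)\<rbrakk> \<Longrightarrow> thesis\<close> by force
  have sub: "cball 0 s \<subseteq> ball (0::complex) r" using assms by auto
  have hol: "(\<lambda>t. exp (H t)) holomorphic_on cball 0 s"
    by (intro holomorphic_intros holomorphic_on_subset[OF assms(1) sub])
  then have cont: "continuous_on (cball 0 s) (\<lambda>t. exp (H t))"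
    by (rule holomorphic_on_imp_continuous_on)
  have "continuous_on (sphere 0 s) (\<lambda>t. cmod (exp (H t)))"
    by (intro continuous_intros continuous_on_subset[OF cont]) auto
  moreover have "sphere (0::complex) s \<noteq> {}"
    using assms(3) by simp
  ultimately obtain t0 where t0: "t0 \<in> sphere 0 s"
    "\<And>t. t \<in> sphere 0 s \<Longrightarrow> cmod (exp (H t)) \<le> cmod (exp (H t0))"
    using continuous_attains_sup[OF compact_sphere] by metis
  \<comment> \<open>The modulus is 1 at the centre, but a negative real part of \<open>H\<close>
    keeps it below 1 on the circle.\<close>
  have "cmod (exp (H 0)) \<le> cmod (exp (H t0))"
  proof (rule maximum_modulus_frontier[where S = "cball 0 s" and f = "\<lambda>t. exp (H t)"])
    show "(\<lambda>t. exp (H t)) holomorphic_on interior (cball 0 s)"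
      by (rule holomorphic_on_subset[OF hol interior_subset])
  qed (use cont t0 assms in auto)
  with neg[of t0] t0(1) assms(2) show False by simp
qed

text \<open>On each small circle there is a \<open>t\<close> at which the part \<open>H\<close> of the pairing that is linear in
  \<open>\<gamma> - a\<close> and \<open>\<delta> - b\<close> has nonnegative real part; dividing the remaining inequality by
  \<open>\<bar>t\<bar>\<^sup>2\<close> gives \<open>\<parallel>u\<parallel>\<^sup>2 \<le> c * \<parallel>u\<parallel>\<^sup>2\<close> in the limit.\<close>

lemma normalized_curves_second_order:
  assumes \<gamma>: "normalized_curve r \<gamma> a u" and \<delta>: "normalized_curve r \<delta> b u"
    and [simp]: "norm a = 1" "norm b = 1"
    and c: "0 \<le> c" "c < 1" "cinner a b = of_real c"
    and le: "\<And>t. t \<in> ball 0 r \<Longrightarrow> cmod (cinner (\<gamma> t) (\<delta> t)) \<le> c * (norm (\<gamma> t) * norm (\<delta> t))"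
  shows "u = 0"
proof -
  have r: "r > 0" and [simp]: "\<gamma> 0 = a" "\<delta> 0 = b"
    using \<gamma> \<delta> by (auto simp: normalized_curve_def)
  \<comment> \<open>The pairing is antiholomorphic in \<open>\<delta>\<close>; swapping the
    arguments in the second term keeps its real part and makes it holomorphic.\<close>
  define H where "H t = cinner (\<gamma> t) b - cinner a b + (cinner (\<delta> t) a - cinner b a)" for t
  have "H holomorphic_on ball 0 r"
    using \<gamma> \<delta> unfolding H_def normalized_curve_def
    by (intro holomorphic_intros holomorphic_on_cinner) auto
  moreover have "H 0 = 0" by (simp add: H_def)
  ultimately have "\<exists>t. cmod t = r / (real n + 2) \<and> Re (H t) \<ge> 0" for n
    by (rule holomorphic_Re_ge_on_circle[where s = "r / (real n + 2)"]) (use r in \<open>auto simp: divide_less_eq\<close>)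
  then obtain t where t: "\<And>n. cmod (t n) = r / (real n + 2)" "\<And>n. Re (H (t n)) \<ge> 0"
    by metis
  have "(\<lambda>n. cmod (t n)) \<longlonglongrightarrow> 0" unfolding t(1) by real_asymp
  then have tlim: "t \<longlonglongrightarrow> 0" by (simp add: tendsto_norm_zero_iff)
  have t0: "t n \<noteq> 0" for n using t(1)[of n] r by auto
  have tball: "t n \<in> ball 0 r" for n using r by (simp add: t divide_less_eq)
  define Q where "Q n = inverse (t n) *s (\<gamma> (t n) - a)" for n
  define R where "R n = inverse (t n) *s (\<delta> (t n) - b)" for n
  have Qlim: "Q \<longlonglongrightarrow> u" and Rlim: "R \<longlonglongrightarrow> u"
    unfolding Q_def R_def
    by (rule normalized_curve_tendsto[OF \<gamma> tlim t0] normalized_curve_tendsto[OF \<delta> tlim t0])+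
  have Q: "\<gamma> (t n) - a = t n *s Q n" and R: "\<delta> (t n) - b = t n *s R n" for n
    by (simp_all add: Q_def R_def t0)
  have ineq: "Re (cinner (Q n) (R n)) \<le> c * ((norm (Q n))\<^sup>2 + (norm (R n))\<^sup>2) / 2" for n
  proof -
    have sq: "x * y \<le> (x\<^sup>2 + y\<^sup>2) / 2" for x y :: real
      using sum_squares_bound[of x y] by simp
    have nn: "(norm (\<gamma> (t n)))\<^sup>2 = 1 + (norm (t n *s Q n))\<^sup>2"
      "(norm (\<delta> (t n)))\<^sup>2 = 1 + (norm (t n *s R n))\<^sup>2"
      using normalized_curve_norm_square[OF \<gamma> _ tball] normalized_curve_norm_square[OF \<delta> _ tball]
      by (simp_all add: Q R)
    have "Re (cinner (\<gamma> (t n)) (\<delta> (t n))) \<le> c * (norm (\<gamma> (t n)) * norm (\<delta> (t n)))"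
      using complex_Re_le_cmod le[OF tball[of n]] by (rule order_trans)
    \<comment> \<open>The inequality of arithmetic and geometric means passes to squared norms, for
      which there is an exact formula.\<close>
    also have "\<dots> \<le> c * (((norm (\<gamma> (t n)))\<^sup>2 + (norm (\<delta> (t n)))\<^sup>2) / 2)"
      by (rule mult_left_mono[OF sq c(1)])
    also have "\<dots> = c + (cmod (t n))\<^sup>2 * (c * ((norm (Q n))\<^sup>2 + (norm (R n))\<^sup>2) / 2)"
      unfolding nn by (simp add: norm_scale power_mult_distrib field_simps)
    finally have 1: "Re (cinner (\<gamma> (t n)) (\<delta> (t n))) \<le> \<dots>" .
    \<comment> \<open>Expansion about \<open>a\<close> and \<open>b\<close>: a constant, two linear
      terms and a mixed term, which is of second order in \<open>t n\<close>.\<close>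
    have "cinner (\<gamma> (t n)) (\<delta> (t n)) = cinner a b + (cinner (\<gamma> (t n)) b - cinner a b)
        + cnj (cinner (\<delta> (t n)) a - cinner b a) + cinner (\<gamma> (t n) - a) (\<delta> (t n) - b)"
      by (simp add: cinner_diff_left cinner_diff_right cnj_cinner)
    then have "Re (cinner (\<gamma> (t n)) (\<delta> (t n))) = c + Re (H (t n)) + Re (cinner (t n *s Q n) (t n *s R n))"
      unfolding Q R H_def using c(3) by simp
    moreover have "cinner (t n *s Q n) (t n *s R n) = of_real ((cmod (t n))\<^sup>2) * cinner (Q n) (R n)"
      using complex_norm_square[of "t n"] by (simp add: cinner_scale_left cinner_scale_right mult.commute)
    ultimately have "c + (cmod (t n))\<^sup>2 * Re (cinner (Q n) (R n)) \<le> Re (cinner (\<gamma> (t n)) (\<delta> (t n)))"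
      using t(2)[of n] by simp
    with 1 have "(cmod (t n))\<^sup>2 * Re (cinner (Q n) (R n)) \<le> (cmod (t n))\<^sup>2 * (c * ((norm (Q n))\<^sup>2 + (norm (R n))\<^sup>2) / 2)"
      by linarith
    then show ?thesis using t0[of n] by (simp add: mult_le_cancel_left)
  qed
  \<comment> \<open>Since the tangent direction is common, both quotients tend to \<open>u\<close>
    and the mixed term tends to the full square of its norm.\<close>
  have "Re (cinner u u) \<le> c * ((norm u)\<^sup>2 + (norm u)\<^sup>2) / 2"
  proof (rule LIMSEQ_le)
    show "(\<lambda>n. Re (cinner (Q n) (R n))) \<longlonglongrightarrow> Re (cinner u u)"
      by (intro tendsto_intros Qlim Rlim)
    show "(\<lambda>n. c * ((norm (Q n))\<^sup>2 + (norm (R n))\<^sup>2) / 2) \<longlonglongrightarrow> c * ((norm u)\<^sup>2 + (norm u)\<^sup>2) / 2"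
      by (intro tendsto_intros Qlim Rlim) auto
  qed (use ineq in auto)
  then have "(1 - c) * (norm u)\<^sup>2 \<le> 0" by (simp add: cinner_self algebra_simps)
  with c(2) show ?thesis by (auto simp: mult_le_0_iff)
qed

section \<open>Cones with tangent directions, and their intersection\<close>

definition complex_cone :: "(complex^'k) set \<Rightarrow> bool" where
  "complex_cone A \<longleftrightarrow> (\<forall>a\<in>A. \<forall>c. c *s a \<in> A)"

text \<open>\<open>A\<close> stands for the cone over an immersed manifold of dimension
  \<open>CARD('n)\<close>, and \<open>D\<close> parametrises the tangent space of that manifold at
  the line of \<open>a\<close>. Here \<open>linear\<close> means real linearity, matching the real
  dimension count below; the complex structure enters through the holomorphic curves.\<close>

definition immersed_cone :: "'n::finite itself \<Rightarrow> (complex^'k) set \<Rightarrow> bool" where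
  "immersed_cone _ A \<longleftrightarrow> (\<forall>a\<in>A. norm a = 1 \<longrightarrow>
     (\<exists>D :: complex^'n::finite \<Rightarrow> complex^'k. linear D \<and> inj D \<and>
       (\<forall>\<xi>. \<exists>r \<gamma>. normalized_curve r \<gamma> a (D \<xi>) \<and> \<gamma> ` ball 0 r \<subseteq> A)))"

text \<open>The ranges of \<open>D\<close> and \<open>E\<close> together with \<open>a\<close> and
  \<open>b\<close> have too many dimensions to be independent. In a linear relation the part in the
  span of \<open>a\<close> and \<open>b\<close> is orthogonal to both vectors, so it vanishes
  because they are linearly independent.\<close>

lemma common_tangent:
  fixes D :: "complex^'n::finite \<Rightarrow> complex^'k::finite" and E :: "complex^'l::finite \<Rightarrow> complex^'k"
  assumes "linear D" "inj D" "linear E" "inj E"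
    and dim: "CARD('k) < CARD('n) + CARD('l) + 2"
    and perp: "\<And>\<xi>. cinner (D \<xi>) a = 0" "\<And>\<xi>. cinner (D \<xi>) b = 0" "\<And>\<eta>. cinner (E \<eta>) a = 0" "\<And>\<eta>. cinner (E \<eta>) b = 0"
    and ab: "norm a = 1" "norm b = 1" "cmod (cinner a b) < 1"
  obtains \<xi> \<eta> where "D \<xi> = E \<eta>" "D \<xi> \<noteq> 0"
proof -
  define T :: "((complex^'n) \<times> (complex^'l)) \<times> complex \<times> complex \<Rightarrow> complex^'k"
    where "T = (\<lambda>((\<xi>, \<eta>), p, q). D \<xi> - E \<eta> + (p *s a + q *s b))"
  have "linear T"
    using assms(1,3) unfolding T_def linear_iff
    by (auto simp: algebra_simps vec_eq_iff)
  have "\<not> inj T"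
  proof
    assume "inj T"
    \<comment> \<open>These are real dimensions: twice \<open>CARD('n) + CARD('l) + 2\<close> and
      twice \<open>CARD('k)\<close>.\<close>
    have "dim (UNIV :: (((complex^'n) \<times> (complex^'l)) \<times> complex \<times> complex) set) \<le> dim (UNIV :: (complex^'k) set)"
      using dim_image_eq[OF \<open>linear T\<close>, of UNIV] \<open>inj T\<close> dim_subset_UNIV[of "range T"]
      by (auto simp: dim_UNIV)
    with dim show False by (simp add: dim_UNIV)
  qed
  then obtain \<xi> \<eta> p q where nz: "((\<xi>, \<eta>), p, q) \<noteq> 0" and T0: "T ((\<xi>, \<eta>), p, q) = 0"
    using linear_injective_0[OF \<open>linear T\<close>] by (metis prod.collapse)
  define w where "w = p *s a + q *s b"
  have DE: "D \<xi> - E \<eta> + w = 0" using T0 by (simp add: T_def w_def)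
  have "cinner (D \<xi> - E \<eta> + w) a = 0" "cinner (D \<xi> - E \<eta> + w) b = 0"
    unfolding DE by (simp_all add: cinner_def)
  then have wab: "cinner w a = 0" "cinner w b = 0"
    by (simp_all add: cinner_add_left cinner_diff_left perp)
  have aa: "cinner a a = 1" "cinner b b = 1" by (simp_all add: cinner_self ab)
  have e1: "p + q * cinner b a = 0" and e2: "p * cinner a b + q = 0"
    using wab by (simp_all add: w_def cinner_add_left cinner_scale_left aa)
  \<comment> \<open>Eliminating \<open>p\<close> leaves \<open>q\<close> times the Gram determinant
    of \<open>a\<close> and \<open>b\<close>, which is nonzero.\<close>
  have "q * (1 - cinner b a * cinner a b) = 0"
    using e1 e2 by algebra
  moreover have "cmod (cinner b a * cinner a b) < 1"
    using ab(3) cnj_cinner[of a b] complex_mod_cnj[of "cinner a b"] power_less_one_iff[of "cmod (cinner a b)" 2]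
    by (simp add: norm_mult flip: power2_eq_square)
  ultimately have "q = 0" by auto
  with e1 have "p = 0" by simp
  have eq: "D \<xi> = E \<eta>" using DE by (simp add: w_def \<open>q = 0\<close> \<open>p = 0\<close>)
  moreover have "D \<xi> \<noteq> 0"
    using nz \<open>q = 0\<close> \<open>p = 0\<close> eq assms(1-4) by (auto simp: linear_injective_0 zero_prod_def)
  ultimately show thesis by (rule that)
qed

text \<open>The summand 2 in the bound is the dimension of the span of \<open>a\<close> and
  \<open>b\<close>: the tangent directions lie in its orthogonal complement and must meet
  there.\<close>

theorem immersed_cones_intersect:
  fixes A B :: "(complex^'k::finite) set"
  assumes A: "complex_cone A" "compact (A \<inter> sphere 0 1)" "A \<inter> sphere 0 1 \<noteq> {}" "immersed_cone TYPE('n::finite) A"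
    and B: "complex_cone B" "compact (B \<inter> sphere 0 1)" "B \<inter> sphere 0 1 \<noteq> {}" "immersed_cone TYPE('l::finite) B"
    and dim: "CARD('k) < CARD('n) + CARD('l) + 2"
  shows "A \<inter> B \<inter> sphere 0 1 \<noteq> {}"
proof
  assume disj: "A \<inter> B \<inter> sphere 0 1 = {}"
  let ?K = "(A \<inter> sphere 0 1) \<times> (B \<inter> sphere 0 1)"
  have "continuous_on ?K (\<lambda>z. cmod (cinner (fst z) (snd z)))"
    by (intro continuous_intros)
  moreover have "compact ?K" "?K \<noteq> {}"
    using A(2,3) B(2,3) by (auto intro: compact_Times)
  ultimately obtain z where z: "z \<in> ?K"
    "\<And>w. w \<in> ?K \<Longrightarrow> cmod (cinner (fst w) (snd w)) \<le> cmod (cinner (fst z) (snd z))"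
    using continuous_attains_sup[of ?K "\<lambda>z. cmod (cinner (fst z) (snd z))"] by blast
  define c where "c = cmod (cinner (fst z) (snd z))"
  define b where "b = snd z"
  \<comment> \<open>Rotating the first vector stays in the cone and makes the maximal pairing
    real.\<close>
  obtain \<omega> where \<omega>: "cmod \<omega> = 1" "cinner (\<omega> *s fst z) b = of_real c"
    unfolding c_def b_def by (rule phase_cinner)
  define a where "a = \<omega> *s fst z"
  have a: "a \<in> A" "norm a = 1" and b: "b \<in> B" "norm b = 1"
    using z(1) A(1) \<omega>(1) by (auto simp: a_def b_def complex_cone_def norm_scale mem_Times_iff)
  have c: "0 \<le> c" "cinner a b = of_real c" by (simp_all add: c_def a_def \<omega>(2)[unfolded c_def])
  \<comment> \<open>By homogeneity the maximum over unit vectors bounds the pairing on the whole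
    cones.\<close>
  have le: "cmod (cinner x y) \<le> c * (norm x * norm y)" if "x \<in> A" "y \<in> B" for x y
  proof (cases "x = 0 \<or> y = 0")
    case True
    then show ?thesis by (auto simp: cinner_def)
  next
    case False
    let ?x = "of_real (inverse (norm x)) *s x" and ?y = "of_real (inverse (norm y)) *s y"
    have "(?x, ?y) \<in> ?K"
      using that False A(1) B(1) by (auto simp: complex_cone_def norm_scale norm_inverse)
    then have "cmod (cinner ?x ?y) \<le> c" using z(2) c_def by fastforce
    moreover have "cmod (cinner ?x ?y) = cmod (cinner x y) / (norm x * norm y)"
      by (simp add: cinner_scale_left cinner_scale_right norm_mult norm_inverse divide_inverse mult_ac)
    ultimately show ?thesis
      using False by (simp add: divide_le_eq)
  qed
  have "c \<le> 1" using norm_cinner_le[of a b] c a b by simp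
  \<comment> \<open>Maximum 1 would give \<open>a = b\<close>, a common unit vector.\<close>
  moreover have "c \<noteq> 1"
    using norm_cinner_eq_1[of a b] a b c disj by auto
  ultimately have c1: "c < 1" by simp
  obtain D :: "complex^'n \<Rightarrow> complex^'k" where D: "linear D" "inj D"
    "\<And>\<xi>. \<exists>r \<gamma>. normalized_curve r \<gamma> a (D \<xi>) \<and> \<gamma> ` ball 0 r \<subseteq> A"
    using A(4) a unfolding immersed_cone_def by metis
  obtain E :: "complex^'l \<Rightarrow> complex^'k" where E: "linear E" "inj E"
    "\<And>\<xi>. \<exists>r \<gamma>. normalized_curve r \<gamma> b (E \<xi>) \<and> \<gamma> ` ball 0 r \<subseteq> B"
    using B(4) b unfolding immersed_cone_def by metis
  have aa: "cinner a a = of_real 1" "cinner b b = of_real 1" by (simp_all add: cinner_self a b)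
  have ba: "cinner b a = of_real c" using cnj_cinner[of a b] c by simp
  have le': "cmod (cinner y x) \<le> c * (norm y * norm x)" if "x \<in> A" "y \<in> B" for x y
    using le[OF that] cnj_cinner[of x y] complex_mod_cnj[of "cinner x y"] by (simp add: mult.commute)
  have perpD: "cinner (D \<xi>) a = 0" "cinner (D \<xi>) b = 0" for \<xi>
  proof -
    obtain r \<gamma> where g: "normalized_curve r \<gamma> a (D \<xi>)" "\<gamma> ` ball 0 r \<subseteq> A" using D(3) by blast
    show "cinner (D \<xi>) a = 0"
      \<comment> \<open>Orthogonality to \<open>a\<close> itself needs only Cauchy-Schwarz; that to
        \<open>b\<close> comes from maximality.\<close>
      using normalized_curve_critical[OF g(1) a(2) _ aa(1)] norm_cinner_le[of _ a] a by simp
    show "cinner (D \<xi>) b = 0"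
      by (rule normalized_curve_critical[OF g(1) a(2) c]) (use le[of _ b] g b in force)
  qed
  have perpE: "cinner (E \<xi>) a = 0" "cinner (E \<xi>) b = 0" for \<xi>
  proof -
    obtain r \<gamma> where g: "normalized_curve r \<gamma> b (E \<xi>)" "\<gamma> ` ball 0 r \<subseteq> B" using E(3) by blast
    show "cinner (E \<xi>) b = 0"
      using normalized_curve_critical[OF g(1) b(2) _ aa(2)] norm_cinner_le[of _ b] b by simp
    show "cinner (E \<xi>) a = 0"
      by (rule normalized_curve_critical[OF g(1) b(2) c(1) ba]) (use le'[of a] g a in force)
  qed
  obtain \<xi> \<eta> where eq: "D \<xi> = E \<eta>" and nz: "D \<xi> \<noteq> 0"
    by (rule common_tangent[OF D(1,2) E(1,2) dim perpD perpE a(2) b(2)]) (use c c1 in auto)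
  obtain r \<gamma> where g: "normalized_curve r \<gamma> a (D \<xi>)" "\<gamma> ` ball 0 r \<subseteq> A" using D(3) by blast
  obtain s \<delta> where d: "normalized_curve s \<delta> b (D \<xi>)" "\<delta> ` ball 0 s \<subseteq> B" using E(3) eq by metis
  have rs: "r > 0" "s > 0" using g d by (auto simp: normalized_curve_def)
  have "D \<xi> = 0"
  proof (rule normalized_curves_second_order)
    show "normalized_curve (min r s) \<gamma> a (D \<xi>)" "normalized_curve (min r s) \<delta> b (D \<xi>)"
      using rs by (auto intro: normalized_curve_mono[OF g(1)] normalized_curve_mono[OF d(1)])
    show "cmod (cinner (\<gamma> t) (\<delta> t)) \<le> c * (norm (\<gamma> t) * norm (\<delta> t))" if "t \<in> ball 0 (min r s)" for t
      using that g d by (intro le) auto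
  qed (use a b c c1 in auto)
  with nz show False ..
qed

subsection \<open>Projective space and its affine charts\<close>

lemma span_line: "vec.span {v} = range (\<lambda>c. c *s v)"
  by (rule vec.span_singleton)

lemma span_scale_eq:
  fixes v :: "complex^'k"
  assumes "c \<noteq> 0"
  shows "vec.span {c *s v} = vec.span {v}"
proof -
  have "v = inverse c *s (c *s v)" using assms by simp
  also have "\<dots> \<in> vec.span {c *s v}" by (intro vec.span_scale vec.span_base) simp
  finally show ?thesis
    by (auto simp: vec.span_eq intro: vec.span_scale vec.span_base)
qed

lemma proj_line_eq_span:
  assumes "L \<in> proj_lines" "v \<in> L" "v \<noteq> 0"
  shows "L = vec.span {v}"
proof -
  obtain w where w: "L = vec.span {w}" using assms(1) by (auto simp: proj_lines_def)
  then obtain c where "v = c *s w" using assms(2) by (auto simp: span_line)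
  then show ?thesis using assms(3) w span_scale_eq[of c w] by auto
qed

lemma proj_line_nonzero:
  assumes "L \<in> proj_lines"
  obtains v where "v \<in> L" "v \<noteq> 0" "L = vec.span {v}"
  using assms vec.span_base by (fastforce simp: proj_lines_def)

lemma span_in_proj_lines: "v \<noteq> 0 \<Longrightarrow> vec.span {v} \<in> proj_lines"
  by (auto simp: proj_lines_def)

section \<open>The quotient topology on the set of lines\<close>

lemma openin_proj_topology:
  fixes U :: "(complex^'k::finite option) set set"
  shows "openin proj_topology U \<longleftrightarrow> U \<subseteq> proj_lines \<and> open {v. v \<noteq> 0 \<and> vec.span {v} \<in> U}"
proof -
  have "istopology (\<lambda>U. U \<subseteq> proj_lines \<and> open {v :: complex^'k option. v \<noteq> 0 \<and> vec.span {v} \<in> U})"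
    unfolding istopology_def
  proof (intro conjI allI impI; (elim conjE)?)
    fix S T :: "(complex^'k option) set set"
    assume "open {v. v \<noteq> 0 \<and> vec.span {v} \<in> S}" "open {v. v \<noteq> 0 \<and> vec.span {v} \<in> T}"
    moreover have "{v. v \<noteq> 0 \<and> vec.span {v} \<in> S \<inter> T} = {v. v \<noteq> 0 \<and> vec.span {v} \<in> S} \<inter> {v. v \<noteq> 0 \<and> vec.span {v} \<in> T}"
      by auto
    ultimately show "open {v. v \<noteq> 0 \<and> vec.span {v} \<in> S \<inter> T}" by (simp add: open_Int)
  next
    fix K :: "(complex^'k option) set set set"
    assume "\<forall>U\<in>K. U \<subseteq> proj_lines \<and> open {v. v \<noteq> 0 \<and> vec.span {v} \<in> U}"
    moreover have "{v. v \<noteq> 0 \<and> vec.span {v} \<in> \<Union>K} = (\<Union>U\<in>K. {v. v \<noteq> 0 \<and> vec.span {v} \<in> U})"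
      by auto
    ultimately show "open {v. v \<noteq> 0 \<and> vec.span {v} \<in> \<Union>K}" by auto
  qed auto
  then show ?thesis by (simp add: proj_topology_def)
qed

lemma topspace_proj_topology [simp]:
  "topspace proj_topology = (proj_lines :: (complex^'k::finite option) set set)"
proof -
  have "{v :: complex^'k option. v \<noteq> 0 \<and> vec.span {v} \<in> proj_lines} = - {0}"
    using span_in_proj_lines by auto
  then have "openin proj_topology (proj_lines :: (complex^'k option) set set)"
    by (simp add: openin_proj_topology open_Compl)
  then show ?thesis
    unfolding topspace_def by (auto simp: openin_proj_topology)
qed

text \<open>Continuity of maps out of projective space can thus be checked on nonzero
  vectors.\<close>

lemma quotient_map_span:
  "quotient_map (top_of_set (- {0})) proj_topology (\<lambda>v :: complex^'k::finite option. vec.span {v})"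
proof -
  have "{x \<in> - {0}. vec.span {x} \<in> U} = {v. v \<noteq> 0 \<and> vec.span {v} \<in> U}" for U :: "(complex^'k option) set set"
    by auto
  moreover have "openin (top_of_set (- {0})) {v. v \<noteq> 0 \<and> vec.span {v} \<in> U} \<longleftrightarrow> open {v. v \<noteq> 0 \<and> vec.span {v} \<in> U}"
    for U :: "(complex^'k option) set set"
    by (subst openin_open_eq) auto
  ultimately show ?thesis
    unfolding quotient_map_def by (auto simp: openin_proj_topology proj_lines_def)
qed

text \<open>Every line contains a unit vector, so projective space is a continuous image of the unit
  sphere.\<close>

lemma compact_space_proj_topology: "compact_space (proj_topology :: (complex^'k::finite option) set topology)"
proof -
  have "compactin (top_of_set (- {0})) (sphere (0 :: complex^'k option) 1)"
    by (auto simp: compactin_subtopology)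
  then have "compactin proj_topology ((\<lambda>v. vec.span {v}) ` sphere (0 :: complex^'k option) 1)"
    using image_compactin quotient_imp_continuous_map[OF quotient_map_span] by blast
  moreover have "(\<lambda>v. vec.span {v}) ` sphere (0 :: complex^'k option) 1 = proj_lines"
  proof -
    have "vec.span {v} \<in> (\<lambda>v. vec.span {v}) ` sphere (0 :: complex^'k option) 1" if "v \<noteq> 0" for v
      using that span_scale_eq[of "of_real (inverse (norm v))" v]
      by (intro image_eqI[of _ _ "of_real (inverse (norm v)) *s v"]) (auto simp: norm_scale norm_inverse)
    then show ?thesis
      by (fastforce simp: proj_lines_def)
  qed
  ultimately show ?thesis by (simp add: compact_space_def)
qed

section \<open>Affine charts and their inverses\<close>

definition affine_embed :: "'k option \<Rightarrow> complex^'k \<Rightarrow> complex^'k::finite option" where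
  "affine_embed i y = (\<chi> l. if l = i then 0 else case l of None \<Rightarrow> y $ the i | Some j \<Rightarrow> y $ j)"

text \<open>The representative with coordinate \<open>i\<close> equal to 1;
  \<open>affine_embed i\<close> is its linear part. There \<open>the i\<close> is reached only for
  \<open>i = Some j\<close>, where \<open>None\<close> receives the entry that
  \<open>affine_coords\<close> stores at \<open>j\<close>.\<close>

definition affine_lift :: "'k option \<Rightarrow> complex^'k \<Rightarrow> complex^'k::finite option" where
  "affine_lift i y = axis i 1 + affine_embed i y"

lemma affine_embed_component [simp]: "affine_embed i y $ i = 0"
  by (simp add: affine_embed_def)

lemma affine_lift_component [simp]: "affine_lift i y $ i = 1"
  by (simp add: affine_lift_def axis_def)

lemma affine_lift_nonzero [simp]: "affine_lift i y \<noteq> 0"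
  by (metis affine_lift_component zero_index zero_neq_one)

lemma affine_embed_add: "affine_embed i (x + y) = affine_embed i x + affine_embed i y"
  by (auto simp: affine_embed_def vec_eq_iff split: option.split)

lemma affine_embed_scale: "affine_embed i (c *s y) = c *s affine_embed i y"
  by (auto simp: affine_embed_def vec_eq_iff split: option.split)

lemma affine_lift_other: "affine_lift i y $ (if i = Some j then None else Some j) = y $ j"
  by (auto simp: affine_lift_def affine_embed_def axis_def)

lemma affine_embed_other: "affine_embed i y $ (if i = Some j then None else Some j) = y $ j"
  by (auto simp: affine_embed_def)

lemma affine_embed_eq_0: "affine_embed i y = 0 \<Longrightarrow> y = 0"
  using affine_embed_other[of i y] by (simp add: vec_eq_iff)

lemma linear_affine_embed: "linear (affine_embed i)"
  by (auto simp: linear_iff affine_embed_add affine_embed_def vec_eq_iff split: option.split)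

lemma affine_lift_has_derivative:
  "(affine_lift i has_derivative affine_embed i) (at y)"
proof -
  have "((\<lambda>y. axis i 1 + affine_embed i y) has_derivative (\<lambda>h. 0 + affine_embed i h)) (at y)"
    using linear_imp_has_derivative[OF linear_affine_embed]
    by (intro has_derivative_add has_derivative_const)
  then show ?thesis by (simp add: affine_lift_def[abs_def])
qed

lemma continuous_on_affine_lift: "continuous_on S (affine_lift i)"
  by (meson affine_lift_has_derivative continuous_at_imp_continuous_on has_derivative_continuous)

text \<open>A line has at most one vector whose coordinate \<open>i\<close> is 1, which resolves the
  definite description.\<close>

lemma affine_coords_eq:
  assumes "L \<in> proj_lines" "v \<in> L" "v $ i = 1"
  shows "affine_coords i L = (\<chi> j. v $ (if i = Some j then None else Some j))"
proof -
  have "v \<noteq> 0" using assms(3) by auto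
  then have L: "L = range (\<lambda>c. c *s v)"
    using proj_line_eq_span[OF assms(1,2)] by (simp add: span_line)
  have "(THE v. v \<in> L \<and> v $ i = 1) = v"
    by (rule the_equality) (use assms in \<open>auto simp: L\<close>)
  then show ?thesis by (simp add: affine_coords_def)
qed

lemma affine_coords_lift: "affine_coords i (vec.span {affine_lift i y}) = y"
proof -
  have "affine_coords i (vec.span {affine_lift i y})
      = (\<chi> j. affine_lift i y $ (if i = Some j then None else Some j))"
    by (intro affine_coords_eq span_in_proj_lines vec.span_base) auto
  then show ?thesis by (simp only: affine_lift_other vec_lambda_eta)
qed

lemma affine_lift_coords:
  assumes "L \<in> fst (affine_chart i)"
  shows "affine_lift i (affine_coords i L) \<in> L"
proof -
  from assms obtain v where v: "L \<in> proj_lines" "v \<in> L" "v $ i \<noteq> 0"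
    by (auto simp: affine_chart_def)
  define w where "w = inverse (v $ i) *s v"
  have "L = vec.span {v}" using v by (intro proj_line_eq_span) auto
  then have w: "w \<in> L" "w $ i = 1"
    using v(3) by (auto simp: w_def intro: vec.span_scale vec.span_base)
  have "affine_lift i (affine_coords i L) = w"
    unfolding affine_coords_eq[OF v(1) w] using w(2)
    by (auto simp: affine_lift_def affine_embed_def axis_def vec_eq_iff split: option.split)
  with w show ?thesis by simp
qed

lemma span_affine_lift_coords:
  assumes "L \<in> fst (affine_chart i)"
  shows "vec.span {affine_lift i (affine_coords i L)} = L"
  using proj_line_eq_span[OF _ affine_lift_coords[OF assms]] assms
  by (auto simp: affine_chart_def)

lemma span_affine_lift_in_chart: "vec.span {affine_lift i y} \<in> fst (affine_chart i)"
  using vec.span_base[of "affine_lift i y" "{affine_lift i y}"]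
  by (force simp: affine_chart_def span_in_proj_lines)

text \<open>The inverse sends \<open>y\<close> to the span of \<open>affine_lift i y\<close>. The
  chart is continuous because on vectors it is given by the quotients of coordinates by
  \<open>v $ i\<close>.\<close>

lemma is_chart_affine: "is_chart proj_topology (affine_chart i)"
proof -
  let ?U = "{L \<in> proj_lines. \<exists>v\<in>L. v $ i \<noteq> 0}"
  have U: "?U = fst (affine_chart i)" by (simp add: affine_chart_def)
  have span: "vec.span {v} \<in> ?U \<longleftrightarrow> v $ i \<noteq> 0" if "v \<noteq> 0" for v
    using span_in_proj_lines[OF that] vec.span_base[of v "{v}"] by (auto simp: span_line)
  have pre: "{v. v \<noteq> 0 \<and> vec.span {v} \<in> ?U} = {v. v $ i \<noteq> 0}"
  proof (rule set_eqI)
    fix v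
    show "v \<in> {v. v \<noteq> 0 \<and> vec.span {v} \<in> ?U} \<longleftrightarrow> v \<in> {v. v $ i \<noteq> 0}"
      using span[of v] by (cases "v = 0") simp_all
  qed
  have "open {v :: complex^'a option. v $ i \<noteq> 0}"
    by (intro open_Collect_neq continuous_intros)
  then have op: "openin proj_topology ?U"
    unfolding openin_proj_topology pre by auto
  have img: "affine_coords i ` ?U = UNIV"
  proof -
    have "y \<in> affine_coords i ` ?U" for y
      unfolding U by (rule image_eqI[where x = "vec.span {affine_lift i y}"])
        (simp_all only: affine_coords_lift span_affine_lift_in_chart)
    then show ?thesis by blast
  qed
  \<comment> \<open>A quotient map restricted to the preimage of an open set is again a quotient
    map.\<close>
  have "quotient_map (subtopology (top_of_set (- {0})) {v. v $ i \<noteq> 0}) (subtopology proj_topology ?U) (\<lambda>v. vec.span {v})"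
    by (rule quotient_map_restriction[OF quotient_map_span]) (use op pre in simp_all)
  then have quo: "quotient_map (top_of_set {v. v $ i \<noteq> 0}) (subtopology proj_topology ?U) (\<lambda>v. vec.span {v})"
  proof -
    have "- {0} \<inter> {v. v $ i \<noteq> 0} = {v :: complex^'a option. v $ i \<noteq> 0}" by auto
    then show ?thesis using \<open>quotient_map _ _ _\<close> by (simp add: subtopology_subtopology)
  qed
  have coords: "affine_coords i (vec.span {v}) = (\<chi> j. v $ (if i = Some j then None else Some j) / v $ i)" if "v $ i \<noteq> 0" for v
  proof -
    have "affine_coords i (vec.span {v}) = (\<chi> j. (inverse (v $ i) *s v) $ (if i = Some j then None else Some j))"
      using that by (intro affine_coords_eq span_in_proj_lines vec.span_scale vec.span_base) auto
    then show ?thesis by (simp add: divide_inverse mult.commute)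
  qed
  have "continuous_on {v. v $ i \<noteq> 0} (affine_coords i \<circ> (\<lambda>v. vec.span {v}))"
  proof (rule continuous_on_eq)
    show "continuous_on {v. v $ i \<noteq> 0}
        (\<lambda>v :: complex^'a option. \<chi> j. v $ (if i = Some j then None else Some j) / v $ i)"
      by (intro continuous_on_vec_lambda allI continuous_on_divide continuous_on_component continuous_on_id) auto
  qed (simp add: coords)
  then have "continuous_map (subtopology proj_topology ?U) euclidean (affine_coords i)"
    by (intro continuous_compose_quotient_map[OF quo]) simp
  moreover have "continuous_map euclidean (subtopology proj_topology ?U) (\<lambda>y. vec.span {affine_lift i y})"
  proof -
    have "continuous_map euclidean (top_of_set (- {0})) (affine_lift i)"
      by (auto simp: continuous_map_in_subtopology continuous_on_affine_lift)
    from continuous_map_compose[OF this quotient_imp_continuous_map[OF quotient_map_span]]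
    show ?thesis
      using span_affine_lift_in_chart unfolding U by (auto simp: continuous_map_in_subtopology o_def)
  qed
  ultimately have "homeomorphic_maps (subtopology proj_topology ?U) euclidean (affine_coords i) (\<lambda>y. vec.span {affine_lift i y})"
    unfolding homeomorphic_maps_def
    by (simp add: U affine_coords_lift span_affine_lift_coords)
  then have "homeomorphic_map (subtopology proj_topology ?U) euclidean (affine_coords i)"
    by (rule homeomorphic_maps_imp_map)
  with op img show ?thesis
    by (simp add: is_chart_def affine_chart_def)
qed

lemma CP_simps [simp]: "points (CP T) = proj_topology" "atlas (CP T) = range affine_chart"
  by (simp_all add: CP_def)

subsection \<open>Immersions into projective space\<close>

text \<open>The orthogonal projection \<open>v v\<^sup>* / \<parallel>v\<parallel>\<^sup>2\<close> onto a line embeds projective space into the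
  matrices, so that closedness can be tested there.\<close>

lemma compact_cone:
  fixes F :: "(complex^'n::finite option) set \<Rightarrow> (complex^'k::finite option) set"
  assumes F: "continuous_map proj_topology proj_topology F"
  shows "compact ((\<Union>L\<in>proj_lines. F L) \<inter> sphere 0 1)"
proof -
  define P where "P v = (\<chi> l j. v $ l * cnj (v $ j) / of_real ((norm v)\<^sup>2))" for v :: "complex^'k option"
  \<comment> \<open>The choice of the vector is immaterial, since \<open>P\<close> is invariant
    under nonzero scaling.\<close>
  define Q where "Q L = P (SOME v. v \<in> L \<and> v \<noteq> 0)" for L
  have P_scale: "P (c *s v) = P v" if "c \<noteq> 0" for c v
    using that complex_norm_square[of c]
    by (simp add: P_def vec_eq_iff norm_scale power_mult_distrib mult_ac)
  have Q: "Q (vec.span {v}) = P v" if "v \<noteq> 0" for v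
  proof -
    define w where "w = (SOME w. w \<in> vec.span {v} \<and> w \<noteq> 0)"
    have "w \<in> vec.span {v} \<and> w \<noteq> 0"
      unfolding w_def by (rule someI[of _ v]) (simp add: that vec.span_base)
    then obtain c where "w = c *s v" "c \<noteq> 0" by (auto simp: span_line)
    then show ?thesis by (simp add: Q_def w_def[symmetric] P_scale)
  qed
  have contP: "continuous_on (- {0}) P"
    unfolding P_def by (intro continuous_on_vec_lambda continuous_intros) auto
  have "continuous_map proj_topology euclidean Q"
    by (rule continuous_compose_quotient_map[OF quotient_map_span])
      (use continuous_on_eq[OF contP] Q in \<open>auto simp: o_def\<close>)
  then have "compactin euclidean (Q ` F ` proj_lines)"
    using compact_space_proj_topology F by (intro image_compactin) (auto simp: compact_space_def)
  then have "closed (Q ` F ` proj_lines)" by (simp add: compact_imp_closed)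
  then have "closed (sphere 0 1 \<inter> P -` (Q ` F ` proj_lines))"
    by (intro continuous_closed_preimage continuous_on_subset[OF contP]) auto
  then have "compact (sphere 0 1 \<inter> P -` (Q ` F ` proj_lines))"
    by (auto simp: compact_eq_bounded_closed intro: bounded_subset[OF bounded_sphere])
  moreover have "sphere 0 1 \<inter> P -` (Q ` F ` proj_lines) = (\<Union>L\<in>proj_lines. F L) \<inter> sphere 0 1"
  proof safe
    fix a L assume a: "a \<in> sphere 0 1" "P a = Q (F L)" and L: "L \<in> proj_lines"
    from L F have FL: "F L \<in> proj_lines" by (auto simp: continuous_map_def)
    then obtain b where b: "b \<in> F L" "b \<noteq> 0" "F L = vec.span {b}" by (rule proj_line_nonzero)
    have eq: "a $ l * cnj (a $ j) = b $ l * cnj (b $ j) / of_real ((norm b)\<^sup>2)" for l j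
      using a Q[OF b(2)] by (simp add: b(3) P_def vec_eq_iff)
    \<comment> \<open>Applying both projections to the unit vector \<open>a\<close> shows that
      \<open>a\<close> is its own projection to the line of \<open>b\<close>.\<close>
    have "a $ l = (cinner a b / of_real ((norm b)\<^sup>2)) * b $ l" for l
    proof -
      have "a $ l = a $ l * cinner a a" using a(1) by (simp add: cinner_self)
      also have "\<dots> = (\<Sum>j\<in>UNIV. (a $ l * cnj (a $ j)) * a $ j)"
        by (simp add: cinner_def sum_distrib_left mult_ac)
      also have "\<dots> = (cinner a b / of_real ((norm b)\<^sup>2)) * b $ l"
        unfolding eq by (simp add: cinner_def sum_distrib_left sum_distrib_right sum_divide_distrib mult_ac)
      finally show ?thesis .
    qed
    then have "a = (cinner a b / of_real ((norm b)\<^sup>2)) *s b" by (simp add: vec_eq_iff)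
    then have "a \<in> F L" unfolding b(3) span_line by (rule range_eqI)
    with L show "a \<in> (\<Union>L\<in>proj_lines. F L)" by auto
  next
    fix a L assume a: "a \<in> sphere 0 1" "a \<in> F L" and L: "L \<in> proj_lines"
    then have "F L = vec.span {a}"
      using F by (intro proj_line_eq_span) (auto simp: continuous_map_def)
    moreover have "a \<noteq> 0" using a by auto
    ultimately have "P a = Q (F L)" by (simp add: Q)
    with L show "a \<in> P -` (Q ` F ` proj_lines)" by auto
  qed
  ultimately show ?thesis by simp
qed

section \<open>Coordinate expressions of immersions, and slices of products\<close>

lemma open_in_charts_dom:
  assumes "is_chart X c" "is_chart Y d" "continuous_map X Y f"
  shows "open (in_charts_dom c d f)"
proof -
  obtain U \<phi> V \<psi> where cd: "c = (U, \<phi>)" "d = (V, \<psi>)" by (cases c, cases d)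
  have hom: "homeomorphic_map (subtopology X U) (top_of_set (\<phi> ` U)) \<phi>" and U: "openin X U" "open (\<phi> ` U)"
    and V: "openin Y V"
    using assms by (auto simp: is_chart_def cd)
  have "openin X ({x \<in> topspace X. f x \<in> V} \<inter> U)"
    using openin_continuous_map_preimage[OF assms(3) V] U by (intro openin_Int) auto
  moreover have "{x \<in> topspace X. f x \<in> V} \<inter> U = U \<inter> f -` V"
    using openin_subset[OF U(1)] by auto
  ultimately have "openin (subtopology X U) (U \<inter> f -` V)"
    using U(1) by (simp add: openin_open_subtopology)
  then have "openin (top_of_set (\<phi> ` U)) (\<phi> ` (U \<inter> f -` V))"
    using homeomorphic_map_openness_eq[OF hom] by blast
  then show ?thesis using U(2) openin_open_trans by (simp add: in_charts_dom_def cd)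
qed

lemma is_chart_inj:
  assumes "is_chart X (U, \<phi>)"
  shows "inj_on \<phi> U"
  using assms openin_subset[of X U] by (auto simp: is_chart_def homeomorphic_eq_everything_map inf_absorb2)

lemma vec_pair_has_derivative:
  fixes a :: "complex^'m::finite"
  shows "((\<lambda>y. vec_pair a y) has_derivative (\<lambda>h. vec_pair 0 h)) (at (y :: complex^'n::finite))"
proof -
  have "linear (\<lambda>h :: complex^'n. vec_pair (0 :: complex^'m) h)"
    by (auto simp: linear_iff vec_pair_def vec_eq_iff split: sum.split)
  then have "((\<lambda>y. vec_pair a 0 + vec_pair 0 y) has_derivative (\<lambda>h. 0 + vec_pair 0 h)) (at y)"
    by (intro has_derivative_add has_derivative_const linear_imp_has_derivative)
  moreover have "(\<lambda>y :: complex^'n. vec_pair a 0 + vec_pair 0 y) = (\<lambda>y. vec_pair a y)"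
    by (auto simp: vec_pair_def vec_eq_iff fun_eq_iff split: sum.split)
  ultimately show ?thesis by simp
qed

lemma vec_pair_eq_iff: "vec_pair a b = vec_pair c d \<longleftrightarrow> a = c \<and> b = d"
  by (auto simp: vec_pair_def vec_eq_iff split_sum_all)

text \<open>The definitions give a complex linear and an injective derivative separately; uniqueness
  of derivatives identifies them.\<close>

lemma holomorphic_immersion_in_charts:
  assumes "holomorphic_immersion M N f" "c \<in> atlas M" "d \<in> atlas N" "x \<in> in_charts_dom c d f"
  obtains D where "(in_charts c d f has_derivative D) (at x)" "Vector_Spaces.linear (*s) (*s) D" "inj D"
  using assms has_derivative_unique
  unfolding holomorphic_immersion_def holomorphic_map_def holomorphic_vec_on_def by metis

text \<open>In a product chart around \<open>p\<close>, the slice is \<open>f\<close> composed with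
  the affine map \<open>vec_pair (\<phi> p)\<close>. By the chain rule its derivative is the
  restriction of an injective complex linear map to the second factor.\<close>

lemma holomorphic_immersion_slice:
  fixes M :: "('a, 'm::finite) complex_space" and N :: "('b, 'n::finite) complex_space"
    and P :: "('c, 'k::finite) complex_space"
  assumes f: "holomorphic_immersion (prod_manifold M N) P f"
    and M: "holomorphic_atlas (points M) (atlas M)" and p: "p \<in> topspace (points M)"
    and N: "\<And>c. c \<in> atlas N \<Longrightarrow> is_chart (points N) c"
    and P: "\<And>c. c \<in> atlas P \<Longrightarrow> is_chart (points P) c"
  shows "holomorphic_immersion N P (\<lambda>q. f (p, q))"
proof -
  let ?F = "\<lambda>q. f (p, q)"
  have "continuous_map (prod_topology (points M) (points N)) (points P) f"
    using f by (simp add: holomorphic_immersion_def holomorphic_map_def prod_manifold_def)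
  moreover have "continuous_map (points N) (prod_topology (points M) (points N)) (\<lambda>q. (p, q))"
    using p by (intro continuous_map_pairedI) auto
  ultimately have cont: "continuous_map (points N) (points P) ?F"
    using continuous_map_compose[of "points N" _ "Pair p" "points P" f] by (simp add: o_def)
  have "\<exists>D. (in_charts c d ?F has_derivative D) (at x) \<and> Vector_Spaces.linear (*s) (*s) D \<and> inj D"
    if c: "c \<in> atlas N" and d: "d \<in> atlas P" and x: "x \<in> in_charts_dom c d ?F" for c d x
  proof -
    obtain V \<psi> W \<kappa> where cd: "c = (V, \<psi>)" "d = (W, \<kappa>)" by (cases c, cases d)
    obtain U \<phi> where u: "(U, \<phi>) \<in> atlas M" "p \<in> U"
      using M p unfolding holomorphic_atlas_def by blast
    let ?C = "prod_chart (U, \<phi>) c"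
    have C: "?C \<in> atlas (prod_manifold M N)"
      using u c unfolding prod_manifold_def complex_space.simps by blast
    have inj: "inj_on \<phi> U" "inj_on \<psi> V"
      using M u N[OF c] by (auto simp: holomorphic_atlas_def cd intro: is_chart_inj)
    have inv: "inv_into (U \<times> V) (\<lambda>(p, q). vec_pair (\<phi> p) (\<psi> q)) (vec_pair (\<phi> p) (\<psi> q)) = (p, q)"
      if "q \<in> V" for q
    proof (rule inv_into_f_eq)
      show "inj_on (\<lambda>(p, q). vec_pair (\<phi> p) (\<psi> q)) (U \<times> V)"
        using inj by (auto simp: inj_on_def vec_pair_eq_iff)
    qed (use that u in auto)
    define S where "S = in_charts_dom c d ?F"
    have "open S" unfolding S_def by (rule open_in_charts_dom[OF N[OF c] P[OF d] cont])
    have eq: "in_charts ?C d f (vec_pair (\<phi> p) y) = in_charts c d ?F y" if y: "y \<in> S" for y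
    proof -
      obtain q where "q \<in> V" "y = \<psi> q" using y by (auto simp: S_def in_charts_dom_def cd)
      then show ?thesis
        by (simp add: in_charts_def prod_chart_def cd inv inv_into_f_f[OF inj(2)])
    qed
    have xC: "vec_pair (\<phi> p) x \<in> in_charts_dom ?C d f"
      using x u unfolding in_charts_dom_def cd prod_chart_def by force
    obtain D where D: "(in_charts ?C d f has_derivative D) (at (vec_pair (\<phi> p) x))"
      "Vector_Spaces.linear (*s) (*s) D" "inj D"
      by (rule holomorphic_immersion_in_charts[OF f C d xC])
    have "((\<lambda>y. in_charts ?C d f (vec_pair (\<phi> p) y)) has_derivative (\<lambda>h. D (vec_pair 0 h))) (at x)"
      by (rule has_derivative_compose[OF vec_pair_has_derivative D(1)])
    then have "(in_charts c d ?F has_derivative (\<lambda>h. D (vec_pair 0 h))) (at x)"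
      by (rule has_derivative_transform_within_open[OF _ \<open>open S\<close>]) (use x eq in \<open>auto simp: S_def\<close>)
    moreover have "Vector_Spaces.linear (*s) (*s) (\<lambda>h. vec_pair (0 :: complex^'m) (h :: complex^'n))"
      by unfold_locales (auto simp: vec_pair_def vec_eq_iff algebra_simps split: sum.split)
    then have "Vector_Spaces.linear (*s) (*s) (\<lambda>h :: complex^'n. D (vec_pair 0 h))"
      using Vector_Spaces.linear_compose[OF _ D(2)] by (simp add: o_def)
    moreover have "inj (\<lambda>h :: complex^'n. D (vec_pair 0 h))"
      by (intro injI) (auto dest!: injD[OF D(3)] simp: vec_pair_eq_iff)
    ultimately show ?thesis by blast
  qed
  with cont show ?thesis
    unfolding holomorphic_immersion_def holomorphic_map_def holomorphic_vec_on_def by meson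
qed

text \<open>In affine charts \<open>F\<close> lifts along complex lines to holomorphic curves of
  vectors; dividing such a curve by its pairing with \<open>a\<close> normalizes it.\<close>

lemma immersed_cone_of_immersion:
  fixes F :: "(complex^'n::finite option) set \<Rightarrow> (complex^'k::finite option) set"
  assumes F: "holomorphic_immersion (CP TYPE('n)) (CP TYPE('k)) F"
  shows "immersed_cone TYPE('n) (\<Union>L\<in>proj_lines. F L)"
  unfolding immersed_cone_def
proof (intro ballI impI)
  fix a assume "a \<in> (\<Union>L\<in>proj_lines. F L)" and na: "norm a = 1"
  then obtain L0 where L0: "L0 \<in> proj_lines" "a \<in> F L0" by auto
  have cont: "continuous_map proj_topology proj_topology F"
    using F by (simp add: holomorphic_immersion_def holomorphic_map_def)
  then have FL: "F L \<in> proj_lines" if "L \<in> proj_lines" for L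
    using that by (auto simp: continuous_map_def)
  have "a \<noteq> 0" using na by auto
  then obtain i where i: "a $ i \<noteq> 0" by (auto simp: vec_eq_iff)
  obtain v where "v \<in> L0" "v \<noteq> 0" using proj_line_nonzero[OF L0(1)] by metis
  then obtain i0 where "v $ i0 \<noteq> 0" by (auto simp: vec_eq_iff)
  then have L0V: "L0 \<in> fst (affine_chart i0)" using \<open>v \<in> L0\<close> L0 by (auto simp: affine_chart_def)
  have FLV: "F L0 \<in> fst (affine_chart i)" using i L0 FL by (auto simp: affine_chart_def)
  define g where "g = in_charts (affine_chart i0) (affine_chart i) F"
  define S where "S = in_charts_dom (affine_chart i0) (affine_chart i) F"
  define y0 where "y0 = affine_coords i0 L0"
  have "open S"
    unfolding S_def by (rule open_in_charts_dom[OF is_chart_affine is_chart_affine cont])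
  have S_eq: "S = affine_coords i0 ` (fst (affine_chart i0) \<inter> F -` fst (affine_chart i))"
    by (simp add: S_def in_charts_dom_def affine_chart_def)
  have "y0 \<in> S" unfolding S_eq y0_def using L0V FLV by auto
  have inj0: "inj_on (affine_coords i0) (fst (affine_chart i0))"
    by (rule is_chart_inj[of proj_topology]) (use is_chart_affine[of i0] in \<open>simp add: affine_chart_def\<close>)
  have g_eq: "g (affine_coords i0 L) = affine_coords i (F L)" if "L \<in> fst (affine_chart i0)" for L
    using inv_into_f_f[OF inj0 that] by (simp add: g_def in_charts_def affine_chart_def)
  have g_cone: "affine_lift i (g y) \<in> (\<Union>L\<in>proj_lines. F L)" if "y \<in> S" for y
  proof -
    obtain L where "L \<in> fst (affine_chart i0)" "F L \<in> fst (affine_chart i)" "y = affine_coords i0 L"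
      using \<open>y \<in> S\<close> by (auto simp: S_eq)
    then show ?thesis
      using affine_lift_coords[of "F L" i] by (auto simp: g_eq affine_chart_def)
  qed
  have g_deriv: "\<exists>E. (g has_derivative E) (at y) \<and> Vector_Spaces.linear (*s) (*s) E \<and> inj E" if "y \<in> S" for y
    using holomorphic_immersion_in_charts[OF F, of "affine_chart i0" "affine_chart i" y] that
    unfolding g_def S_def CP_simps by (metis rangeI)
  define l0 where "l0 = affine_lift i (g y0)"
  define s where "s = cinner l0 a"
  have "l0 \<in> F L0" using affine_lift_coords[OF FLV] by (simp add: l0_def y0_def g_eq[OF L0V])
  then have "F L0 = vec.span {l0}" using FL L0 by (intro proj_line_eq_span) (auto simp: l0_def)
  then obtain k where k: "a = k *s l0" using L0(2) by (auto simp: span_line)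
  \<comment> \<open>This is the pairing of \<open>a\<close> with itself. Hence \<open>s\<close> is
    nonzero, so the lift can be normalized near the base point.\<close>
  have "k * s = 1"
    using cinner_self[of a] na by (simp add: s_def k cinner_scale_left[of k l0, symmetric])
  then have s: "s \<noteq> 0" "a = inverse s *s l0" using k inverse_unique[of s k] by (auto simp: mult.commute)
  obtain E where E: "(g has_derivative E) (at y0)" "Vector_Spaces.linear (*s) (*s) E" "inj E"
    using g_deriv[OF \<open>y0 \<in> S\<close>] by blast
  define e where "e \<xi> = affine_embed i (E \<xi>)" for \<xi>
  \<comment> \<open>The quotient rule for the lift divided by its pairing with \<open>a\<close>,
    evaluated at 0.\<close>
  define D where "D \<xi> = inverse s *s e \<xi> - (cinner (e \<xi>) a / s\<^sup>2) *s l0" for \<xi>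
  have linE: "E (x + y) = E x + E y" "E (c *s x) = c *s E x" for x y c
    using E(2) by (simp_all add: Vector_Spaces.linear_iff)
  have e_lin: "e (x + y) = e x + e y" "e (c *s x) = c *s e x" for x y c
    by (simp_all add: e_def linE affine_embed_add affine_embed_scale)
  have "linear D"
  proof (rule linearI)
    show "D (x + y) = D x + D y" for x y
      by (simp add: D_def e_lin cinner_add_left vec_eq_iff algebra_simps add_divide_distrib)
    have scl: "c *\<^sub>R x = complex_of_real c *s x" for c and x :: "complex^'z"
      by (simp add: vec_eq_iff) (simp add: scaleR_conv_of_real)
    show "D (c *\<^sub>R x) = c *\<^sub>R D x" for c x
      unfolding scl by (simp add: D_def e_lin cinner_scale_left vec_eq_iff algebra_simps)
  qed
  moreover have "inj D"
    unfolding linear_injective_0[OF \<open>linear D\<close>]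
  proof (intro allI impI)
    fix \<xi> assume "D \<xi> = 0"
    then have *: "inverse s * e \<xi> $ j = (cinner (e \<xi>) a / s\<^sup>2) * l0 $ j" for j
      by (simp add: D_def vec_eq_iff)
    \<comment> \<open>In coordinate \<open>i\<close>, the tangent vector \<open>e \<xi>\<close> is 0
      while \<open>l0\<close> is 1, so the multiple of \<open>l0\<close> must vanish.\<close>
    from *[of i] have "cinner (e \<xi>) a = 0" using s by (simp add: e_def l0_def)
    then have "inverse s * e \<xi> $ j = 0" for j unfolding * by simp
    then have "e \<xi> = 0" using s(1) by (simp add: vec_eq_iff)
    then have "E \<xi> = 0" unfolding e_def by (rule affine_embed_eq_0)
    moreover have "E 0 = 0" using linE(2)[of 0 0] by simp
    ultimately show "\<xi> = 0" using E(3) by (metis injD)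
  qed
  moreover have "\<exists>r \<gamma>. normalized_curve r \<gamma> a (D \<xi>) \<and> \<gamma> ` ball 0 r \<subseteq> (\<Union>L\<in>proj_lines. F L)" for \<xi>
  proof -
    define l where "l t = affine_lift i (g (y0 + t *s \<xi>))" for t
    define h where "h t = cinner (l t) a" for t
    define R where "R = {t. y0 + t *s \<xi> \<in> S}"
    have path: "((\<lambda>t. y0 + t *s \<xi>) has_derivative (\<lambda>t. 0 + t *s \<xi>)) (at t)" for t
    proof -
      have "linear (\<lambda>t. t *s \<xi>)"
        by (auto simp: linear_iff vec_eq_iff algebra_simps)
      then show ?thesis
        by (intro has_derivative_add has_derivative_const linear_imp_has_derivative)
    qed
    then have "continuous_on UNIV (\<lambda>t. y0 + t *s \<xi>)"
      by (meson continuous_at_imp_continuous_on has_derivative_continuous)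
    then have "open R" unfolding R_def
      using open_vimage[OF \<open>open S\<close>, of "\<lambda>t. y0 + t *s \<xi>"] by (simp add: vimage_def)
    have l_deriv: "((\<lambda>t. l t $ j) has_field_derivative affine_embed i (E' \<xi>) $ j) (at t)"
      if E': "(g has_derivative E') (at (y0 + t *s \<xi>))" "Vector_Spaces.linear (*s) (*s) E'" for t j E'
    proof -
      have "((\<lambda>t. g (y0 + t *s \<xi>)) has_derivative (\<lambda>t. E' (t *s \<xi>))) (at t)"
        using has_derivative_compose[OF path E'(1)] by simp
      then have "(l has_derivative (\<lambda>t. affine_embed i (E' (t *s \<xi>)))) (at t)"
        unfolding l_def[abs_def] by (rule has_derivative_compose[OF _ affine_lift_has_derivative])
      then have "((\<lambda>t. l t $ j) has_derivative (\<lambda>t. affine_embed i (E' (t *s \<xi>)) $ j)) (at t)"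
        by (rule bounded_linear.has_derivative[OF bounded_linear_vec_nth])
      \<comment> \<open>Complex linearity turns the real derivative into a complex derivative in
        \<open>t\<close>.\<close>
      moreover have "E' (t *s \<xi>) = t *s E' \<xi>" for t
        using E'(2) by (simp add: Vector_Spaces.linear_iff)
      ultimately show ?thesis
        by (simp add: affine_embed_scale has_field_derivative_def mult_commute_abs)
    qed
    have l_hol: "(\<lambda>t. l t $ j) holomorphic_on R" for j
      unfolding holomorphic_on_open[OF \<open>open R\<close>]
    proof
      fix t assume "t \<in> R"
      then show "\<exists>l'. ((\<lambda>t. l t $ j) has_field_derivative l') (at t)"
        using g_deriv l_deriv unfolding R_def by blast
    qed
    then have h_hol: "h holomorphic_on R" unfolding h_def by (rule holomorphic_on_cinner)
    have "0 \<in> R" and l_0: "l 0 = l0" and h_0: "h 0 = s"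
      using \<open>y0 \<in> S\<close> by (simp_all add: R_def l_def l0_def h_def s_def)
    have "open (R \<inter> h -` (- {0}))"
      by (intro continuous_open_preimage holomorphic_on_imp_continuous_on h_hol \<open>open R\<close>) auto
    \<comment> \<open>On a small ball the curve stays in the chart domain and its pairing with
      \<open>a\<close> stays nonzero.\<close>
    then obtain r where r: "r > 0" "ball 0 r \<subseteq> R \<inter> h -` (- {0})"
      using \<open>0 \<in> R\<close> h_0 s by (metis ComplI IntI open_contains_ball singletonD vimageI)
    have ball: "t \<in> R" "h t \<noteq> 0" if "t \<in> ball 0 r" for t
      using r(2) that by blast+
    define \<gamma> where "\<gamma> t = inverse (h t) *s l t" for t
    have "normalized_curve r \<gamma> a (D \<xi>)"
      unfolding normalized_curve_def
    proof (intro conjI ballI allI)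
      show "r > 0" by fact
      show "\<gamma> 0 = a" by (simp add: \<gamma>_def l_0 h_0 s)
      show "cinner (\<gamma> t) a = 1" if "t \<in> ball 0 r" for t
        using ball[OF that] by (auto simp: \<gamma>_def cinner_scale_left h_def[symmetric])
      show "(\<lambda>t. \<gamma> t $ j) holomorphic_on ball 0 r" for j
        using ball unfolding \<gamma>_def vector_smult_component
        by (intro holomorphic_on_mult holomorphic_on_inverse
            holomorphic_on_subset[OF l_hol] holomorphic_on_subset[OF h_hol]) blast+
      show "((\<lambda>t. \<gamma> t $ j) has_field_derivative D \<xi> $ j) (at 0)" for j
      proof -
        have dl: "((\<lambda>t. l t $ j) has_field_derivative e \<xi> $ j) (at 0)" for j
          using l_deriv[of E 0] E by (simp add: e_def)
        have dh: "(h has_field_derivative cinner (e \<xi>) a) (at 0)"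
          unfolding h_def[abs_def] cinner_def by (intro DERIV_sum DERIV_cmult_right dl)
        have "((\<lambda>t. l t $ j / h t) has_field_derivative (e \<xi> $ j * h 0 - l 0 $ j * cinner (e \<xi>) a) / (h 0 * h 0)) (at 0)"
          by (rule DERIV_divide[OF dl dh]) (simp add: h_0 s)
        moreover have "(e \<xi> $ j * h 0 - l 0 $ j * cinner (e \<xi>) a) / (h 0 * h 0) = D \<xi> $ j"
          using s by (simp add: D_def h_0 l_0 field_simps power2_eq_square)
        ultimately show ?thesis by (simp add: \<gamma>_def divide_inverse mult.commute)
      qed
    qed
    moreover have "\<gamma> ` ball 0 r \<subseteq> (\<Union>L\<in>proj_lines. F L)"
    proof safe
      fix t assume "t \<in> ball (0::complex) r"
      then have "l t \<in> (\<Union>L\<in>proj_lines. F L)" using ball(1) g_cone by (auto simp: R_def l_def)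
      then obtain L where L: "L \<in> proj_lines" "l t \<in> F L" by auto
      then obtain w where "F L = vec.span {w}" using FL by (auto simp: proj_lines_def)
      with L show "\<gamma> t \<in> (\<Union>L\<in>proj_lines. F L)"
        by (auto simp: \<gamma>_def intro!: bexI[of _ L] vec.span_scale)
    qed
    ultimately show ?thesis by blast
  qed
  ultimately show "\<exists>D :: complex^'n \<Rightarrow> _. linear D \<and> inj D \<and>
      (\<forall>\<xi>. \<exists>r \<gamma>. normalized_curve r \<gamma> a (D \<xi>) \<and> \<gamma> ` ball 0 r \<subseteq> (\<Union>L\<in>proj_lines. F L))"
    by blast
qed

section \<open>Intersection of immersed projective spaces, and the conclusion\<close>

theorem immersed_projective_spaces_intersect:
  fixes F :: "(complex^'n::finite option) set \<Rightarrow> (complex^'k::finite option) set"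
    and G :: "(complex^'l::finite option) set \<Rightarrow> (complex^'k option) set"
  assumes F: "holomorphic_immersion (CP TYPE('n)) (CP TYPE('k)) F"
    and G: "holomorphic_immersion (CP TYPE('l)) (CP TYPE('k)) G"
    and dim: "CARD('k) \<le> CARD('n) + CARD('l)"
  shows "F ` proj_lines \<inter> G ` proj_lines \<noteq> {}"
proof -
  have cone: "complex_cone (\<Union>L\<in>proj_lines. H L)" "(\<Union>L\<in>proj_lines. H L) \<inter> sphere 0 1 \<noteq> {}"
    if H: "continuous_map proj_topology proj_topology H"
    for H :: "(complex^'z::finite option) set \<Rightarrow> (complex^'k option) set"
  proof -
    have HL: "H L \<in> proj_lines" if "L \<in> proj_lines" for L
      using that H by (auto simp: continuous_map_def)
    then show cone: "complex_cone (\<Union>L\<in>proj_lines. H L)"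
      unfolding complex_cone_def by (fastforce simp: proj_lines_def intro: vec.span_scale)
    \<comment> \<open>Any line would serve; its image provides a unit vector in the cone.\<close>
    define L :: "(complex^'z option) set" where "L = vec.span {axis None 1}"
    have L: "L \<in> proj_lines" unfolding L_def by (rule span_in_proj_lines) (simp add: axis_eq_0_iff)
    from HL[OF L] obtain v where v: "v \<in> H L" "v \<noteq> 0" by (rule proj_line_nonzero)
    then have "of_real (inverse (norm v)) *s v \<in> (\<Union>L\<in>proj_lines. H L) \<inter> sphere 0 1"
      using cone L by (auto simp: complex_cone_def norm_scale norm_inverse)
    then show "(\<Union>L\<in>proj_lines. H L) \<inter> sphere 0 1 \<noteq> {}" by blast
  qed
  have contF: "continuous_map proj_topology proj_topology F" and contG: "continuous_map proj_topology proj_topology G"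
    using F G by (auto simp: holomorphic_immersion_def holomorphic_map_def)
  \<comment> \<open>The cones lie in a space of dimension \<open>CARD('k) + 1\<close>, so
    \<open>dim\<close> becomes the strict bound required for cones.\<close>
  have "(\<Union>L\<in>proj_lines. F L) \<inter> (\<Union>L\<in>proj_lines. G L) \<inter> sphere 0 1 \<noteq> {}"
    using dim
    by (intro immersed_cones_intersect[OF cone(1)[OF contF] compact_cone[OF contF] cone(2)[OF contF]
          immersed_cone_of_immersion[OF F] cone(1)[OF contG] compact_cone[OF contG] cone(2)[OF contG]
          immersed_cone_of_immersion[OF G]]) simp
  then obtain a L L' where a: "a \<in> F L" "a \<in> G L'" "norm a = 1" "L \<in> proj_lines" "L' \<in> proj_lines"
    by auto
  have "F L \<in> proj_lines" "G L' \<in> proj_lines"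
    using contF contG a by (auto simp: continuous_map_def)
  moreover have "a \<noteq> 0" using a by auto
  ultimately have "F L = G L'" using a proj_line_eq_span by metis
  with a show ?thesis by blast
qed

theorem theorem1:
  fixes M :: "('a, 'm::finite) complex_space"
  assumes "complex_manifold M" and "compact_space (points M)"
    and "CARD('n::finite) > CARD('m)"
    and "CARD('k::finite) = CARD('m) + CARD('n) + 1"
  shows "\<not> (\<exists>f. holomorphic_embedding (prod_manifold M (CP TYPE('n))) (CP TYPE('k)) f)"
proof
  assume "\<exists>f. holomorphic_embedding (prod_manifold M (CP TYPE('n))) (CP TYPE('k)) f"
  then obtain f where f: "holomorphic_immersion (prod_manifold M (CP TYPE('n))) (CP TYPE('k)) f"
    and inj: "inj_on f (topspace (points M) \<times> proj_lines)"
    by (auto simp: holomorphic_embedding_def prod_manifold_def)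
  have M: "holomorphic_atlas (points M) (atlas M)" "topspace (points M) \<noteq> {}"
    using assms(1) by (auto simp: complex_manifold_def)
  then obtain U \<phi> where U: "(U, \<phi>) \<in> atlas M" "U \<noteq> {}"
    unfolding holomorphic_atlas_def by blast
  then have chart: "is_chart (points M) (U, \<phi>)" using M by (auto simp: holomorphic_atlas_def)
  then have "open (\<phi> ` U)" "U \<subseteq> topspace (points M)"
    by (auto simp: is_chart_def openin_subset)
  \<comment> \<open>A nonempty open subset of a coordinate space of positive dimension is infinite;
    this yields two distinct points of \<open>M\<close>.\<close>
  have "infinite (\<phi> ` U)"
    using \<open>open (\<phi> ` U)\<close> U(2) finite_imp_not_open by blast
  then have "\<not> U \<subseteq> {p}" for p
    by (meson finite.emptyI finite_imageI finite_insert finite_subset)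
  then obtain p q where "p \<in> U" "q \<in> U" "p \<noteq> q"
    using U(2) by blast
  then have pq: "p \<in> topspace (points M)" "q \<in> topspace (points M)" "p \<noteq> q"
    using \<open>U \<subseteq> topspace (points M)\<close> by auto
  have "holomorphic_immersion (CP TYPE('n)) (CP TYPE('k)) (\<lambda>L. f (x, L))" if "x \<in> topspace (points M)" for x
    by (rule holomorphic_immersion_slice[OF f M(1) that]) (auto simp: is_chart_affine)
  \<comment> \<open>The hypothesis on dimensions enters as
    \<open>CARD('m) + CARD('n) + 1 \<le> CARD('n) + CARD('n)\<close>.\<close>
  then have "(\<lambda>L. f (p, L)) ` proj_lines \<inter> (\<lambda>L. f (q, L)) ` proj_lines \<noteq> {}"
    using pq assms(3,4) by (intro immersed_projective_spaces_intersect) auto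
  with inj pq show False by (auto simp: inj_on_def)
qed

end
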